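(* Let $a,b,m\in\mathbb{Z}$ with $a\ge 2$, $m>1$, $\gcd(b,m)=1$, and $b\ge -(a-2)m-2$, and let $S=S_{a,b}(m)$ and $d=(a-1)m+b$. Let $n$ be the smallest positive integer such that $A_n\ge m$, let $A=\{A_1,\ldots,A_{n-1}\}$, and for $0\le\ell\le m-1$ set $W(\ell)=d\ell+\mathsf{m}_A(\ell)m$. For $\ell\in\{0,\ldots,m-1\}$, we have $W(\ell)\in\operatorname{Maximals}_{\preceq_S}(\operatorname{Ap}(S))$ if and only if $\mathsf{m}_A(\ell+A_j)\le \mathsf{m}_A(\ell)$ for every $j\in\{1,\ldots,n-1\}$ such that $\ell+A_j<m$.
   Context: $\mathbb{N}=\{0,1,2,\dots\}$. Let $T_{a,b}(z)=az+b$, with $T_{a,b}^i$ its $i$-fold composition ($T_{a,b}^0$ the identity), and let $S_{a,b}(m)=\langle T_{a,b}^i(m)\mid i\ge 0\rangle$ be the submonoid of $(\mathbb{N},+)$ generated by the orbit of $m$; under the stated hypotheses it is a numerical semigroup (finite complement in $\mathbb{N}$) whose smallest positive element is $m$. Set $A_i=(a^i-1)/(a-1)$ for $i\ge 0$ (so $A_1=1$); since $m>1$, $n\ge 2$. The Apéry set is $\operatorname{Ap}(S)=\{s\in S\mid s-m\notin S\}$; under the stated hypotheses $\operatorname{Ap}(S)=\{W(0),\ldots,W(m-1)\}$. The order $\preceq_S$ is $x\preceq_S y$ iff $y-x\in S$, and $\operatorname{Maximals}_{\preceq_S}(\operatorname{Ap}(S))$ is the set of maximal elements of $\operatorname{Ap}(S)$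 for $\preceq_S$. $\mathsf{m}_A(x)$ is the minimum of $\sum_{i=1}^{n-1}u_i$ over all $(u_1,\ldots,u_{n-1})\in\mathbb{N}^{n-1}$ with $x=\sum_{i=1}^{n-1}u_iA_i$. *)

theory Defs
  imports Main
begin

text \<open>Everything lives in \<^typ>\<open>int\<close>, so that \<open>s - m\<close> and \<open>y - x\<close> below are genuine differences.\<close>

inductive_set submonoid_gen :: "int set \<Rightarrow> int set" for X :: "int set" where
  zero: "0 \<in> submonoid_gen X"
| gen: "x \<in> X \<Longrightarrow> x \<in> submonoid_gen X"
| add: "x \<in> submonoid_gen X \<Longrightarrow> y \<in> submonoid_gen X \<Longrightarrow> x + y \<in> submonoid_gen X"

definition affine :: "int \<Rightarrow> int \<Rightarrow> int \<Rightarrow> int" where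
  "affine a b z = a * z + b"

text \<open>The generated submonoid is taken in the integers. If the orbit of \<open>m\<close> consists of
  nonnegative numbers, it is the submonoid of the natural numbers generated by the orbit.
  That is the case when \<open>a \<ge> 2\<close>, \<open>m > 1\<close> and \<open>b \<ge> - (a - 2) * m - 2\<close>: the \<open>i\<close>-th iterate is
  \<open>m + ((a - 1) * m + b) * (1 + a + \<dots> + a ^ (i - 1))\<close> and \<open>(a - 1) * m + b \<ge> m - 2 \<ge> 0\<close>.\<close>

definition orbit_semigroup :: "int \<Rightarrow> int \<Rightarrow> int \<Rightarrow> int set" where
  "orbit_semigroup a b m = submonoid_gen {(affine a b ^^ i) m | i. True}"

text \<open>The division is exact for \<open>a \<ge> 2\<close>.\<close>

definition repunit :: "int \<Rightarrow> nat \<Rightarrow> int" where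
  "repunit a i = (a ^ i - 1) div (a - 1)"

definition Apery :: "int set \<Rightarrow> int \<Rightarrow> int set" where
  "Apery S m = {s \<in> S. s - m \<notin> S}"

definition semigroup_le :: "int set \<Rightarrow> int \<Rightarrow> int \<Rightarrow> bool" where
  "semigroup_le S x y \<longleftrightarrow> y - x \<in> S"

definition Maximals :: "('a \<Rightarrow> 'a \<Rightarrow> bool) \<Rightarrow> 'a set \<Rightarrow> 'a set" where
  "Maximals le X = {x \<in> X. \<forall>y \<in> X. le x y \<longrightarrow> y = x}"

text \<open>\<open>min_length A n x\<close> is the least number of summands, counted with multiplicity, in a
  representation of \<open>x\<close> by \<open>A 1, \<dots>, A (n - 1)\<close>; only the values \<open>u 1, \<dots>, u (n - 1)\<close> of the
  coefficient function matter. It is unspecified if there is no representation, which does not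
  occur for \<open>x \<ge> 0\<close>, \<open>n \<ge> 2\<close> and \<open>A 1 = 1\<close>.\<close>

definition min_length :: "(nat \<Rightarrow> int) \<Rightarrow> nat \<Rightarrow> int \<Rightarrow> nat" where
  "min_length A n x =
     (LEAST k. \<exists>u :: nat \<Rightarrow> nat. x = (\<Sum>i=1..n-1. int (u i) * A i) \<and> k = (\<Sum>i=1..n-1. u i))"

end

theory Submission
  imports Defs
begin

text \<open>Put \<open>d = (a - 1) m + b\<close>. The orbit of \<open>m\<close> is \<open>m + d A\<^sub>i\<close>, so an element of \<open>S\<close> is
  \<open>k m + d x\<close> with \<open>x\<close> a sum of at most \<open>k\<close> repunits. Since \<open>d \<ge> m - 2\<close>, adding a positive
  multiple of \<open>m\<close> to \<open>x\<close> never pays off, and \<open>W(l)\<close> is the least element of \<open>S\<close> congruent to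
  \<open>d l\<close> modulo \<open>m\<close>. If \<open>W(l)\<close> is not maximal then some \<open>W(l) + m + d A\<^sub>j\<close> is again in the Apery
  set. If \<open>l + A\<^sub>j < m\<close>, it equals \<open>W(l + A\<^sub>j)\<close> and the length goes up by one. Wrapping around,
  \<open>l + A\<^sub>j \<ge> m\<close>, is only possible for \<open>l = 0\<close>, where the length goes up along \<open>A\<^sub>1 = 1\<close>.\<close>

section \<open>Submonoids generated by a set\<close>

lemma submonoid_gen_sum:
  "(\<And>i. i \<in> I \<Longrightarrow> f i \<in> submonoid_gen X) \<Longrightarrow> sum f I \<in> submonoid_gen X"
  by (induction I rule: infinite_finite_induct) (auto intro: submonoid_gen.intros)

lemma submonoid_gen_mult:
  "x \<in> submonoid_gen X \<Longrightarrow> int k * x \<in> submonoid_gen X"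
  by (induction k) (auto simp: algebra_simps intro: submonoid_gen.intros)

text \<open>Lets a nonzero difference in \<open>S\<close> be peeled by a single generator, so that
  failure of maximality can be tested on generators alone.\<close>

lemma submonoid_gen_split:
  assumes "s \<in> submonoid_gen X" "s \<noteq> 0"
  obtains g t where "g \<in> X" "t \<in> submonoid_gen X" "s = g + t"
  using assms
proof (induction arbitrary: thesis)
  case zero
  then show ?case by simp
next
  case (gen x)
  then show ?case
    by (metis add.right_neutral submonoid_gen.zero)
next
  case (add x y)
  show ?case
  proof (cases "x = 0")
    case True
    with add.IH(2) add.prems(2) obtain g t where "g \<in> X" "t \<in> submonoid_gen X" "y = g + t"
      by auto
    with True add.prems(1) show ?thesis by simp
  next
    case False
    with add.IH(1) obtain g t where "g \<in> X" "t \<in> submonoid_gen X" "x = g + t" by blast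
    with add.prems(1)[of g "t + y"] add.hyps(2) show ?thesis
      by (simp add: submonoid_gen.add)
  qed
qed

section \<open>Repunits and the orbit of the affine map\<close>

lemma repunit_0: "repunit a 0 = 0"
  by (simp add: repunit_def)

lemma repunit_eq_sum:
  assumes "a \<ge> 2"
  shows "repunit a i = (\<Sum>j<i. a ^ j)"
proof -
  have "a ^ i - 1 = (a - 1) * (\<Sum>j<i. a ^ j)"
    by (rule power_diff_1_eq)
  then show ?thesis
    using assms by (simp add: repunit_def)
qed

lemma repunit_Suc:
  assumes "a \<ge> 2"
  shows "repunit a (Suc i) = a * repunit a i + 1"
  using assms sum.lessThan_Suc_shift[of "\<lambda>j. a ^ j" i]
  by (simp add: repunit_eq_sum sum_distrib_left)

lemma repunit_mono:
  assumes "a \<ge> 2" "i \<le> j"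
  shows "repunit a i \<le> repunit a j"
  unfolding repunit_eq_sum[OF assms(1)]
  by (rule sum_mono2) (use assms in auto)

lemma repunit_ge:
  assumes "a \<ge> 2"
  shows "repunit a i \<ge> int i"
proof -
  have "(\<Sum>j<i. (1::int)) \<le> (\<Sum>j<i. a ^ j)"
    by (rule sum_mono) (use assms in simp)
  then show ?thesis
    using assms by (simp add: repunit_eq_sum)
qed

text \<open>Successive differences along the orbit start at \<open>(a - 1) * z + b\<close> and grow
  by the factor \<open>a\<close>, so they add up to a geometric sum.\<close>

lemma affine_funpow:
  assumes "a \<ge> 2"
  shows "(affine a b ^^ i) z = z + ((a - 1) * z + b) * repunit a i"
proof (induction i)
  case 0
  show ?case by (simp add: repunit_0)
next
  case (Suc i)
  have "(affine a b ^^ Suc i) z = a * (affine a b ^^ i) z + b"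
    by (simp add: affine_def)
  then show ?case
    unfolding Suc.IH by (simp add: repunit_Suc[OF assms] algebra_simps)
qed

lemma orbit_semigroup_eq:
  assumes "a \<ge> 2"
  shows "orbit_semigroup a b m
    = submonoid_gen (range (\<lambda>i. m + ((a - 1) * m + b) * repunit a i))"
  by (simp add: orbit_semigroup_def affine_funpow[OF assms] full_SetCompr_eq)

section \<open>Lengths of representations\<close>

lemma min_length_le:
  "x = (\<Sum>i=1..n-1. int (u i) * A i) \<Longrightarrow> min_length A n x \<le> (\<Sum>i=1..n-1. u i)"
  unfolding min_length_def by (rule Least_le) blast

text \<open>Collects the only facts about repunits that the argument uses. By \<open>A_ge\<close>,
  every nonzero \<open>A i\<close> below \<open>m\<close> has its index in \<open>{1..n-1}\<close>,
  the range over which \<open>len\<close> sums.\<close>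

locale shifted_generators =
  fixes A :: "nat \<Rightarrow> int" and n :: nat and m d :: int
  assumes A_0: "A 0 = 0" and A_1: "A 1 = 1" and A_pos: "i > 0 \<Longrightarrow> A i > 0"
    and A_ge: "n \<le> i \<Longrightarrow> m \<le> A i"
    and n_ge: "n \<ge> 2" and m_gt: "m > 1" and d_ge: "d \<ge> m - 2" and coprime: "coprime d m"
begin

abbreviation len :: "int \<Rightarrow> nat" where "len \<equiv> min_length A n"
abbreviation S :: "int set" where "S \<equiv> submonoid_gen (range (\<lambda>i. m + d * A i))"
abbreviation W :: "int \<Rightarrow> int" where "W x \<equiv> d * x + int (len x) * m"

text \<open>For \<open>m = 2\<close> the bound \<open>d_ge\<close> still allows
  \<open>d = 0\<close>; coprimality rules it out, since \<open>gcd 0 m = m > 1\<close>.\<close>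

lemma d_pos: "d > 0"
proof -
  have "d \<noteq> 0"
    using coprime m_gt by auto
  then show ?thesis
    using d_ge m_gt by linarith
qed

lemma one_index: "1 \<in> {1..n-1}"
  using n_ge by auto

lemma rep_multiple:
  assumes "j \<in> {1..n-1}"
  shows "(\<Sum>i=1..n-1. int (if i = j then k else 0) * A i) = int k * A j"
    and "(\<Sum>i=1..n-1. if i = j then k else 0) = k"
proof -
  have "(\<Sum>i=1..n-1. int (if i = j then k else 0) * A i)
      = (\<Sum>i=1..n-1. if i = j then int k * A j else 0)"
    by (rule sum.cong) auto
  then show "(\<Sum>i=1..n-1. int (if i = j then k else 0) * A i) = int k * A j"
    using assms by simp
  show "(\<Sum>i=1..n-1. if i = j then k else 0) = k"
    using assms by simp
qed

lemma len_le_of_multiple: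
  assumes "j \<in> {1..n-1}"
  shows "len (int k * A j) \<le> k"
  using min_length_le[where A = A and n = n and u = "\<lambda>i. if i = j then k else 0"] rep_multiple[OF assms, of k]
  by simp

lemma len_le_self:
  assumes "x \<ge> 0"
  shows "int (len x) \<le> x"
  using len_le_of_multiple[OF one_index, of "nat x"] A_1 assms by simp

lemma len_0: "len 0 = 0"
  using len_le_self[of 0] by simp

text \<open>Since \<open>A 1 = 1\<close>, taking it \<open>x\<close> times represents
  \<open>x\<close>. So the \<open>LEAST\<close> in \<open>min_length\<close> ranges over a nonempty
  set and a minimizing \<open>u\<close> exists.\<close>

lemma len_attained:
  assumes "x \<ge> 0"
  obtains u where "x = (\<Sum>i=1..n-1. int (u i) * A i)" "len x = (\<Sum>i=1..n-1. u i)"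
proof -
  have "x = (\<Sum>i=1..n-1. int (if i = 1 then nat x else 0) * A i)"
    using rep_multiple(1)[OF one_index, of "nat x"] A_1 assms by simp
  then have "\<exists>u :: nat \<Rightarrow> nat. x = (\<Sum>i=1..n-1. int (u i) * A i)"
    by (rule exI[of _ "\<lambda>i. if i = 1 then nat x else 0"])
  then have "\<exists>k. \<exists>u :: nat \<Rightarrow> nat. x = (\<Sum>i=1..n-1. int (u i) * A i) \<and> k = (\<Sum>i=1..n-1. u i)"
    by blast
  from LeastI_ex[OF this] show ?thesis
    using that unfolding min_length_def by blast
qed

lemma len_eq_0_imp:
  assumes "x \<ge> 0" "len x = 0"
  shows "x = 0"
proof -
  obtain u where u: "x = (\<Sum>i=1..n-1. int (u i) * A i)" "len x = (\<Sum>i=1..n-1. u i)"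
    using len_attained[OF assms(1)] .
  have "\<forall>i\<in>{1..n-1}. u i = 0"
    using u(2) assms(2) by simp
  then show ?thesis
    using u(1) by simp
qed

lemma len_add:
  assumes "x \<ge> 0" "y \<ge> 0"
  shows "len (x + y) \<le> len x + len y"
proof -
  obtain u where u: "x = (\<Sum>i=1..n-1. int (u i) * A i)" "len x = (\<Sum>i=1..n-1. u i)"
    using len_attained[OF assms(1)] .
  obtain v where v: "y = (\<Sum>i=1..n-1. int (v i) * A i)" "len y = (\<Sum>i=1..n-1. v i)"
    using len_attained[OF assms(2)] .
  have "x + y = (\<Sum>i=1..n-1. int (u i + v i) * A i)"
    by (subst u(1), subst v(1)) (simp add: sum.distrib distrib_right)
  from min_length_le[OF this] show ?thesis
    using u(2) v(2) by (simp add: sum.distrib)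
qed

section \<open>Elements of the semigroup and its Apery set\<close>

text \<open>Addition preserves this form because \<open>len\<close> is subadditive. The bound on
  \<open>len\<close> is claimed only below \<open>m\<close>: a generator with
  \<open>i \<ge> n\<close> has \<open>A i \<ge> m\<close> and may need several of the summands that
  \<open>len\<close> counts. From \<open>m\<close> on, \<open>k > 0\<close> is enough for
  \<open>W_le\<close>.\<close>

lemma S_elem:
  assumes "s \<in> S"
  shows "\<exists>k x. s = int k * m + d * x \<and> x \<ge> 0 \<and> (x > 0 \<longrightarrow> k > 0) \<and> (x < m \<longrightarrow> len x \<le> k)"
  using assms
proof induction
  case zero
  show ?case
    by (rule exI[of _ 0], rule exI[of _ 0]) (simp add: len_0)
next
  case (gen s)
  then obtain i where i: "s = m + d * A i" by blast
  have "A i \<ge> 0"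
    using A_0 A_pos[of i] by (cases "i = 0") auto
  moreover have "len (A i) \<le> 1" if "A i < m"
  proof (cases "i = 0")
    case True
    then show ?thesis by (simp add: A_0 len_0)
  next
    case False
    have "\<not> n \<le> i"
      using A_ge[of i] that by auto
    with False show ?thesis
      using len_le_of_multiple[of i 1] by simp
  qed
  ultimately show ?case
    using i by (intro exI[of _ 1] exI[of _ "A i"]) simp
next
  case (add s t)
  then obtain j x k y where
    "s = int j * m + d * x" "x \<ge> 0" "x > 0 \<longrightarrow> j > 0" "x < m \<longrightarrow> len x \<le> j"
    "t = int k * m + d * y" "y \<ge> 0" "y > 0 \<longrightarrow> k > 0" "y < m \<longrightarrow> len y \<le> k"
    by blast
  moreover from this have "x + y < m \<longrightarrow> len (x + y) \<le> j + k"
    using len_add[of x y] by auto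
  ultimately show ?case
    by (intro exI[of _ "j + k"] exI[of _ "x + y"]) (auto simp: algebra_simps)
qed

lemma m_in_S: "m \<in> S"
  by (rule submonoid_gen.gen, rule range_eqI[of _ _ 0]) (simp add: A_0)

text \<open>Replacing each summand \<open>A i\<close> of a shortest representation by the generator
  \<open>m + d * A i\<close> contributes one \<open>m\<close> per summand.\<close>

lemma W_in_S:
  assumes "x \<ge> 0"
  shows "W x \<in> S"
proof -
  obtain u where u: "x = (\<Sum>i=1..n-1. int (u i) * A i)" "len x = (\<Sum>i=1..n-1. u i)"
    using len_attained[OF assms] .
  have "W x = d * (\<Sum>i=1..n-1. int (u i) * A i) + int (\<Sum>i=1..n-1. u i) * m"
    using u by simp
  also have "\<dots> = (\<Sum>i=1..n-1. int (u i) * (m + d * A i))"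
    by (simp add: sum_distrib_left sum_distrib_right sum.distrib algebra_simps)
  also have "\<dots> \<in> S"
    by (intro submonoid_gen_sum submonoid_gen_mult submonoid_gen.gen) blast
  finally show ?thesis .
qed

text \<open>Coprimality turns the congruence into \<open>x = l + m * q\<close> with
  \<open>q \<ge> 0\<close>, so the claim reduces to comparing the coefficients of
  \<open>m\<close>.\<close>

lemma W_le:
  assumes "s \<in> S" "m dvd s - d * l" "0 \<le> l" "l < m"
  shows "W l \<le> s"
proof -
  obtain k x where s: "s = int k * m + d * x" and x: "x \<ge> 0" "x > 0 \<longrightarrow> k > 0"
    "x < m \<longrightarrow> len x \<le> k"
    using S_elem[OF assms(1)] by blast
  have "s - d * l = d * (x - l) + m * int k"
    by (simp add: s algebra_simps)
  then have "m dvd d * (x - l)"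
    using assms(2) by (metis dvd_add_left_iff dvd_triv_left)
  then have "m dvd x - l"
    using coprime by (simp add: coprime_commute coprime_dvd_mult_right_iff)
  then obtain q where q: "x = l + m * q"
    by (metis dvdE add.commute diff_add_cancel)
  have q0: "q \<ge> 0"
  proof (rule ccontr)
    assume "\<not> q \<ge> 0"
    then have "m * q \<le> m * (-1)"
      using m_gt by (intro mult_left_mono) auto
    then show False
      using q x(1) assms(4) by simp
  qed
  have "int (len l) \<le> int k + d * q"
  proof (cases "q = 0")
    case True
    then show ?thesis
      using q x(3) assms(4) by simp
  next
    case False
    \<comment> \<open>Here \<open>x > 0\<close>, so \<open>k > 0\<close> and
      \<open>int k + d * q \<ge> 1 + d \<ge> m - 1 \<ge> l \<ge> len l\<close>. This is where the
      bound on \<open>d\<close> is needed.\<close>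
    then have "d * 1 \<le> d * q" "m * 1 \<le> m * q"
      using q0 d_pos m_gt by (intro mult_left_mono; simp)+
    then show ?thesis
      using len_le_self[OF assms(3)] assms(3,4) d_ge m_gt q x(2) by linarith
  qed
  then have "int (len l) * m \<le> (int k + d * q) * m"
    using m_gt by (intro mult_right_mono) auto
  then show ?thesis
    by (simp add: s q algebra_simps)
qed

text \<open>\<open>W l - m\<close> lies in the same residue class, below the minimum given by
  \<open>W_le\<close>.\<close>

lemma W_in_Apery:
  assumes "0 \<le> l" "l < m"
  shows "W l \<in> Apery S m"
proof -
  have "m dvd W l - m - d * l"
    by simp
  then show ?thesis
    using W_in_S W_le[of "W l - m" l] assms m_gt unfolding Apery_def by auto
qed

text \<open>By \<open>W_le\<close> such an \<open>s\<close> is \<open>W l + m * j\<close> with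
  \<open>j \<ge> 0\<close>, and for \<open>j \<ge> 1\<close> subtracting \<open>m\<close> would stay
  in \<open>S\<close>.\<close>

lemma Apery_eq_W:
  assumes "s \<in> Apery S m" "m dvd s - d * l" "0 \<le> l" "l < m"
  shows "s = W l"
proof -
  have s: "s \<in> S" "s - m \<notin> S"
    using assms(1) by (auto simp: Apery_def)
  have "m dvd s - d * l - m * int (len l)"
    using assms(2) by (rule dvd_diff) simp
  then obtain j where "s - d * l - m * int (len l) = m * j" ..
  then have j: "s = W l + m * j"
    by (simp add: algebra_simps)
  have "m * j \<ge> 0"
    using W_le[OF s(1) assms(2-4)] j by simp
  then have "j \<ge> 0"
    using m_gt by (simp add: zero_le_mult_iff)
  moreover have False if "j \<ge> 1"
  proof -
    have "int (nat (j - 1)) * m \<in> S"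
      by (rule submonoid_gen_mult[OF m_in_S])
    then have "W l + (j - 1) * m \<in> S"
      using submonoid_gen.add[OF W_in_S[OF assms(3)]] that by simp
    then show False
      using s(2) j by (simp add: algebra_simps)
  qed
  ultimately have "j = 0" by fastforce
  then show ?thesis
    using j by simp
qed

section \<open>Maximal elements and growth of the length\<close>

lemma not_maximal_of_len_less:
  assumes "0 \<le> l" "j \<in> {1..n-1}" "l + A j < m" "len l < len (l + A j)"
  shows "W l \<notin> Maximals (semigroup_le S) (Apery S m)"
proof
  assume max: "W l \<in> Maximals (semigroup_le S) (Apery S m)"
  have Aj: "A j > 0"
    using A_pos[of j] assms(2) by simp
  \<comment> \<open>Subadditivity lets the length grow by at most one, so \<open>W (l + A j)\<close>
    exceeds \<open>W l\<close> by exactly one generator.\<close>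
  have "len (l + A j) \<le> len l + len (A j)" "len (A j) \<le> 1"
    using len_add[of l "A j"] Aj assms len_le_of_multiple[OF assms(2), of 1] by auto
  then have "len (l + A j) = Suc (len l)"
    using assms(4) by linarith
  then have W: "W (l + A j) = W l + (m + d * A j)"
    by (simp add: algebra_simps)
  have "semigroup_le S (W l) (W (l + A j))"
    unfolding W semigroup_le_def by (auto intro: submonoid_gen.gen)
  moreover have "W (l + A j) \<in> Apery S m"
    using W_in_Apery[of "l + A j"] Aj assms by simp
  ultimately have "W (l + A j) = W l"
    using max unfolding Maximals_def by blast
  moreover have "d * A j > 0"
    using d_pos Aj by simp
  ultimately show False
    using W m_gt by linarith
qed

text \<open>Peeling one generator off \<open>y - W l\<close> yields an Apery element
  \<open>z\<close> one generator above \<open>W l\<close>. By uniqueness \<open>z = W r\<close>, and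
  comparing coefficients gives \<open>len r = len l + 1 + d * q\<close>, where \<open>q\<close>
  counts the wraps past \<open>m\<close>.\<close>

lemma len_less_of_not_maximal:
  assumes l: "0 \<le> l" "l < m" and nmax: "W l \<notin> Maximals (semigroup_le S) (Apery S m)"
  shows "\<exists>j\<in>{1..n-1}. l + A j < m \<and> len l < len (l + A j)"
proof (cases "l = 0")
  case True
  have "len 1 \<noteq> 0"
    using len_eq_0_imp[of 1] by auto
  then show ?thesis
    using True n_ge m_gt A_1 by (intro bexI[of _ 1]) (auto simp: len_0)
next
  case False
  obtain y where y: "y \<in> Apery S m" "y - W l \<in> S" "y \<noteq> W l"
    using nmax W_in_Apery[OF l] unfolding Maximals_def semigroup_le_def by auto
  have "y - W l \<noteq> 0"
    using y(3) by simp
  then obtain g t where g: "g \<in> range (\<lambda>i. m + d * A i)" and gt: "t \<in> S" "y - W l = g + t"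
    using submonoid_gen_split[OF y(2)] by metis
  from g obtain i where "g = m + d * A i" ..
  with gt have t: "t \<in> S" "y - W l = (m + d * A i) + t"
    by simp_all
  define z where "z = W l + (m + d * A i)"
  have y_eq: "y = z + t"
    using t(2) unfolding z_def by linarith
  have "z \<in> S"
    unfolding z_def using W_in_S[OF l(1)] by (blast intro: submonoid_gen.intros)
  \<comment> \<open>The Apery set is closed downwards in \<open>S\<close>: adding \<open>t\<close>
    to \<open>z - m\<close> would put \<open>y - m\<close> into \<open>S\<close>.\<close>
  moreover have "z - m \<notin> S"
  proof
    assume "z - m \<in> S"
    from submonoid_gen.add[OF this t(1)] have "y - m \<in> S"
      unfolding y_eq by (simp add: algebra_simps)
    then show False
      using y(1) by (simp add: Apery_def)
  qed
  ultimately have z: "z \<in> Apery S m"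
    by (simp add: Apery_def)
  \<comment> \<open>Index 0 is the generator \<open>m\<close> itself, and subtracting it from
    \<open>z\<close> leads back to \<open>W l\<close>.\<close>
  have i: "i \<noteq> 0"
  proof
    assume "i = 0"
    then have "z - m = W l"
      by (simp add: z_def A_0)
    then show False
      using \<open>z - m \<notin> S\<close> W_in_S[OF l(1)] by simp
  qed
  define r q where "r = (l + A i) mod m" and "q = (l + A i) div m"
  have rq: "l + A i = r + m * q"
    by (simp add: r_def q_def)
  have r: "0 \<le> r" "r < m"
    using m_gt by (auto simp: r_def)
  have z_eq: "z = d * r + m * (int (len l) + 1 + d * q)"
  proof -
    have "z = d * (l + A i) + m * (int (len l) + 1)"
      by (simp add: z_def algebra_simps)
    then show ?thesis
      unfolding rq by (simp add: algebra_simps)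
  qed
  have "z = W r"
    by (rule Apery_eq_W[OF z _ r]) (simp add: z_eq)
  then have "m * (int (len l) + 1 + d * q) = m * int (len r)"
    using z_eq by (simp add: mult.commute)
  then have len: "int (len l) + 1 + d * q = int (len r)"
    using m_gt by simp
  have "q = 0"
  proof (rule ccontr)
    assume "q \<noteq> 0"
    moreover have "q \<ge> 0"
      unfolding q_def using A_pos[of i] i l m_gt by (simp add: pos_imp_zdiv_nonneg_iff)
    ultimately have "d * 1 \<le> d * q"
      using d_pos by (intro mult_left_mono) auto
    \<comment> \<open>With \<open>len l \<ge> 1\<close>, a wrap would force
      \<open>len r \<ge> d + 2 \<ge> m\<close>, against \<open>len r \<le> r < m\<close>. For
      \<open>l = 0\<close> this estimate misses by one, hence the separate case.\<close>
    moreover have "len l \<noteq> 0"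
      using len_eq_0_imp[OF l(1)] False by blast
    ultimately show False
      using len len_le_self[OF r(1)] r(2) d_ge by linarith
  qed
  then have "l + A i = r" "len r = Suc (len l)"
    using rq len by simp_all
  moreover have "\<not> n \<le> i"
    using A_ge[of i] \<open>l + A i = r\<close> r l by auto
  ultimately show ?thesis
    using r i by (intro bexI[of _ i]) auto
qed

theorem W_maximal_iff:
  assumes "0 \<le> l" "l < m"
  shows "W l \<in> Maximals (semigroup_le S) (Apery S m) \<longleftrightarrow>
    (\<forall>j\<in>{1..n-1}. l + A j < m \<longrightarrow> len (l + A j) \<le> len l)"
  using not_maximal_of_len_less[OF assms(1)] len_less_of_not_maximal[OF assms]
  by (meson linorder_not_le)

end

section \<open>Repunits as an instance\<close>

theorem theorem5p5:
  fixes a b m d l :: int and n :: nat and S :: "int set" and A :: "nat \<Rightarrow> int"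
    and m\<^sub>A :: "int \<Rightarrow> nat" and W :: "int \<Rightarrow> int"
  assumes "a \<ge> 2" and "m > 1" and "gcd b m = 1" and "b \<ge> - (a - 2) * m - 2"
    and "S = orbit_semigroup a b m"
    and "d = (a - 1) * m + b"
    and "A = repunit a"
    and "n = (LEAST k. 0 < k \<and> A k \<ge> m)"
    and "m\<^sub>A = min_length A n"
    and "W = (\<lambda>x. d * x + int (m\<^sub>A x) * m)"
    and "l \<in> {0..m-1}"
  shows "W l \<in> Maximals (semigroup_le S) (Apery S m) \<longleftrightarrow>
    (\<forall>j \<in> {1..n-1}. l + A j < m \<longrightarrow> m\<^sub>A (l + A j) \<le> m\<^sub>A l)"
proof -
  have A_1: "A 1 = 1"
    using repunit_Suc[OF assms(1), of 0] by (simp add: assms(7) repunit_0)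
  \<comment> \<open>The bound \<open>A i \<ge> i\<close> makes \<open>nat m\<close> a candidate, so
    the \<open>LEAST\<close> defining \<open>n\<close> is attained.\<close>
  have "0 < nat m \<and> A (nat m) \<ge> m"
    using repunit_ge[OF assms(1), of "nat m"] assms(2,7) by simp
  then have n: "0 < n \<and> A n \<ge> m"
    unfolding assms(8) by (rule LeastI)
  then have "n \<noteq> 1"
    using A_1 assms(2) by auto
  moreover have "gcd d m = 1"
    using gcd_add_mult[of m "a - 1" b] assms(3) by (simp add: assms(6) gcd.commute)
  ultimately interpret shifted_generators A n m d
  proof unfold_locales
    show "A 0 = 0"
      by (simp add: assms(7) repunit_0)
    show "A i > 0" if "i > 0" for i
      using repunit_ge[OF assms(1), of i] that by (simp add: assms(7))
    show "m \<le> A i" if "n \<le> i" for i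
      using n repunit_mono[OF assms(1) that] by (simp add: assms(7))
    \<comment> \<open>The hypothesis on \<open>b\<close> rearranged:
      \<open>d - (m - 2) = (a - 2) * m + b + 2\<close>.\<close>
    show "d \<ge> m - 2"
      using assms(4) by (simp add: assms(6) algebra_simps)
  qed (use A_1 n assms(2) in \<open>auto simp: coprime_iff_gcd_eq_1\<close>)
  show ?thesis
    using W_maximal_iff[of l] assms(11)
    unfolding assms(5,9,10) orbit_semigroup_eq[OF assms(1)] assms(6)[symmetric] assms(7)[symmetric]
    by simp
qed

end
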